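(* Let \((P,\lambda)\) be a regular marked poset. Then the facets of \(\mathcal{O}(P,\lambda)\) are in bijection with the covering relations of \(P\): for each covering relation \(p\prec q\) the partition of \(P\) whose only non-singleton block is \(\{p,q\}\) is the face partition of a facet, and every facet arises in this way from exactly one covering relation.
   Context: A marked poset \((P,\lambda)\) is a finite poset \(P\) with an induced subposet \(P^*\subseteq P\) of marked elements and an order-preserving map \(\lambda\colon P^*\to\mathbb{R}\). The marked order polyhedron \(\mathcal{O}(P,\lambda)\subseteq\mathbb{R}^P\) is the set of all \(x\in\mathbb{R}^P\) with \(x_p\le x_q\) whenever \(p\le q\) and \(x_a=\lambda(a)\) for \(a\in P^*\). We write \(p\prec q\) if \(q\) covers \(p\). A covering relation \(p\prec q\) is non-redundant if for all marked elements \(a,b\in P^*\) with \(a\le q\) and \(p\le b\) one has \(a=b\) or \(\lambda(a)<\lambda(b)\); \((P,\lambda)\) is regular if all its covering relations are non-redundant. For \(x\in\mathcal{O}(P,\lambda)\), \(\pi_x\) is the partition of \(P\) into equivalence classes of the transitive closure of "\(p\sim q\) if \(x_p=x_q\) and \(p,q\) comparable"; the face partition of a non-empty face \(F\) is \(\pi_x\) for any \(x\) in the relative interior of \(F\). *)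

theory Defs
  imports "HOL-Analysis.Analysis"
begin

text \<open>
  The poset \<open>P\<close> is the type \<open>'p\<close> of class \<open>{finite, order}\<close>, so that \<open>\<real>\<^sup>P\<close> is \<open>real ^ 'p\<close>.
  A marked poset is given by the set \<open>M\<close> of marked elements and a marking \<open>lam\<close> with
  \<open>mono_on M lam\<close>; the values of \<open>lam\<close> outside \<open>M\<close> are never used.
\<close>

definition covered_by :: "'p::order \<Rightarrow> 'p \<Rightarrow> bool"
  where "covered_by p q \<longleftrightarrow> p < q \<and> (\<nexists>r. p < r \<and> r < q)"

definition marked_order_polyhedron :: "'p::{finite,order} set \<Rightarrow> ('p \<Rightarrow> real) \<Rightarrow> (real ^ 'p::{finite,order}) set"
  where "marked_order_polyhedron M lam =
    {x. (\<forall>p q. p \<le> q \<longrightarrow> x $ p \<le> x $ q) \<and> (\<forall>a\<in>M. x $ a = lam a)}"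

definition nonredundant :: "'p::order set \<Rightarrow> ('p \<Rightarrow> real) \<Rightarrow> 'p \<Rightarrow> 'p \<Rightarrow> bool"
  where "nonredundant M lam p q \<longleftrightarrow>
    (\<forall>a\<in>M. \<forall>b\<in>M. a \<le> q \<and> p \<le> b \<longrightarrow> a = b \<or> lam a < lam b)"

definition regular_marking :: "'p::order set \<Rightarrow> ('p \<Rightarrow> real) \<Rightarrow> bool"
  where "regular_marking M lam \<longleftrightarrow> (\<forall>p q. covered_by p q \<longrightarrow> nonredundant M lam p q)"

definition tie_rel :: "real ^ 'p::{finite,order} \<Rightarrow> 'p rel"
  where "tie_rel x = {(p, q). x $ p = x $ q \<and> (p \<le> q \<or> q \<le> p)}"

text \<open>\<open>tie_rel x\<close> is reflexive and symmetric, so its transitive closure is an equivalence relation.\<close>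

definition point_partition :: "real ^ 'p::{finite,order} \<Rightarrow> 'p set set"
  where "point_partition x = UNIV // (tie_rel x)\<^sup>+"

text \<open>
  The face partition of a face is a relation rather than a choice function: all points of the
  relative interior are required to induce the same partition. The non-emptiness condition rules
  out vacuity; for convex \<open>F\<close> it is equivalent to \<open>F \<noteq> {}\<close>.
\<close>

definition is_face_partition :: "(real ^ 'p::{finite,order}) set \<Rightarrow> 'p set set \<Rightarrow> bool"
  where "is_face_partition F \<pi> \<longleftrightarrow>
    rel_interior F \<noteq> {} \<and> (\<forall>x\<in>rel_interior F. point_partition x = \<pi>)"

definition pair_partition :: "'p \<Rightarrow> 'p \<Rightarrow> 'p set set"
  where "pair_partition p q = insert {p, q} {{r} | r. r \<noteq> p \<and> r \<noteq> q}"

end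

theory Submission
  imports Defs
begin

text \<open>
  Regularity yields a point \<open>w\<close> that satisfies all marking equations and is strict on every covering
  relation, and for each covering relation \<open>p \<prec> q\<close> a point \<open>z\<close> that satisfies the marking equations,
  is strict on all other covering relations and violates \<open>x\<^sub>p \<le> x\<^sub>q\<close>. Hence the covering relations give
  an irredundant system of inequalities relative to the affine hull, so that the facets are exactly
  the sets where one of them is tight. The segment from \<open>w\<close> to \<open>z\<close> meets this facet in a point where
  \<open>x\<^sub>p = x\<^sub>q\<close> is the only tight covering relation; the same then holds on the whole relative interior.
\<close>

section \<open>Strictly monotone extension of markings\<close>

lemma finite_sets_separated_real:
  fixes A B :: "real set"
  assumes "finite A" "finite B" "\<And>a b. a \<in> A \<Longrightarrow> b \<in> B \<Longrightarrow> a < b"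
  obtains v where "\<And>a. a \<in> A \<Longrightarrow> a < v" "\<And>b. b \<in> B \<Longrightarrow> v < b"
proof -
  have "\<exists>v. (\<forall>a\<in>A. a < v) \<and> (\<forall>b\<in>B. v < b)"
  proof (cases "A = {} \<or> B = {}")
    case True
    moreover obtain u where "\<forall>a\<in>A. a \<le> u"
      using bdd_above_finite[OF assms(1)] unfolding bdd_above_def by auto
    then have "\<forall>a\<in>A. a < u + 1" by force
    moreover obtain l where "\<forall>b\<in>B. l \<le> b"
      using bdd_below_finite[OF assms(2)] unfolding bdd_below_def by auto
    then have "\<forall>b\<in>B. l - 1 < b" by force
    ultimately show ?thesis by auto
  next
    case False
    then have "Max A < Min B" using assms by simp
    then obtain v where "Max A < v" "v < Min B" using dense by blast
    then show ?thesis using assms False by auto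
  qed
  then show ?thesis using that by blast
qed

text \<open>The elements outside \<open>M\<close> receive values one at a time. By transitivity of
  \<open>R\<close>, every value below a new element \<open>r\<close> is smaller than every value
  above it, so finiteness leaves room for a value in between. An arbitrary strict relation
  \<open>R\<close> is allowed because the result is applied both to \<open><\<close> and to a
  modified order.\<close>

lemma strict_mono_extension:
  fixes R :: "'p::finite \<Rightarrow> 'p \<Rightarrow> bool" and g :: "'p \<Rightarrow> real"
  assumes "irreflp R" "transp R"
    and "\<And>a b. a \<in> M \<Longrightarrow> b \<in> M \<Longrightarrow> R a b \<Longrightarrow> g a < g b"
  shows "\<exists>h. (\<forall>a\<in>M. h a = g a) \<and> (\<forall>a b. R a b \<longrightarrow> h a < h b)"
  using assms(3)
proof (induction "card (- M)" arbitrary: M g)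
  case 0
  then have "M = UNIV" by auto
  with "0.prems" show ?case by auto
next
  case (Suc n)
  then have "- M \<noteq> {}" by force
  then obtain r where r: "r \<notin> M" by auto
  obtain v where v: "\<And>a. a \<in> g ` {a\<in>M. R a r} \<Longrightarrow> a < v" "\<And>b. b \<in> g ` {b\<in>M. R r b} \<Longrightarrow> v < b"
  proof (rule finite_sets_separated_real)
    fix a b assume "a \<in> g ` {a\<in>M. R a r}" "b \<in> g ` {b\<in>M. R r b}"
    then show "a < b" using transpD[OF \<open>transp R\<close>] Suc.prems by fast
  qed auto
  have "- insert r M = - M - {r}" by auto
  then have "n = card (- insert r M)" using Suc.hyps(2) r by simp
  moreover have "(g(r := v)) a < (g(r := v)) b"
    if "a \<in> insert r M" "b \<in> insert r M" "R a b" for a b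
    using that v r Suc.prems irreflpD[OF \<open>irreflp R\<close>] by auto
  ultimately obtain h where h: "\<forall>a\<in>insert r M. h a = (g(r := v)) a" "\<forall>a b. R a b \<longrightarrow> h a < h b"
    using Suc.hyps(1) by blast
  then show ?case using r by (intro exI[of _ h]) auto
qed

section \<open>Reduction to covering relations\<close>

lemma covered_by_below:
  fixes p q :: "'p::{finite,order}"
  assumes "p < q"
  obtains r where "covered_by p r" "r \<le> q"
proof -
  obtain r where "r \<in> {p<..q}" and min: "\<And>s. s \<in> {p<..q} \<Longrightarrow> s \<le> r \<Longrightarrow> r = s"
    using finite_has_minimal[of "{p<..q}"] assms by auto
  then have "covered_by p r" unfolding covered_by_def
    by (metis greaterThanAtMost_iff less_le order_trans)
  with \<open>r \<in> {p<..q}\<close> that show ?thesis by auto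
qed

text \<open>In a finite poset \<open>p\<close> is joined to \<open>q\<close> by a chain of covers;
  the induction runs on the number of elements above \<open>p\<close>, which drops on passing to a
  cover.\<close>

lemma mono_if_covered_by_le:
  fixes f :: "'p::{finite,order} \<Rightarrow> 'b::preorder"
  assumes "\<And>p q. covered_by p q \<Longrightarrow> f p \<le> f q" and "p \<le> q"
  shows "f p \<le> f q"
  using assms(2)
proof (induction "card {p<..}" arbitrary: p rule: less_induct)
  case less
  show ?case
  proof (cases "p = q")
    case False
    with less.prems obtain r where r: "covered_by p r" "r \<le> q"
      using covered_by_below[of p q] by (metis order_le_imp_less_or_eq)
    then have "{r<..} \<subset> {p<..}" unfolding covered_by_def by auto
    then have "f r \<le> f q" using less.hyps r by (simp add: psubset_card_mono)
    with assms(1) r show ?thesis by (blast intro: order_trans)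
  qed simp
qed

lemma marked_order_polyhedron_covered_by:
  "marked_order_polyhedron M lam =
    {x. (\<forall>p q. covered_by p q \<longrightarrow> x $ p \<le> x $ q) \<and> (\<forall>a\<in>M. x $ a = lam a)}"
proof -
  have "(\<forall>p q. p \<le> q \<longrightarrow> x $ p \<le> x $ q) \<longleftrightarrow> (\<forall>p q. covered_by p q \<longrightarrow> x $ p \<le> x $ q)"
    for x :: "real ^ 'a::{finite,order}"
    using mono_if_covered_by_le[of "($) x"] by (auto simp: covered_by_def)
  then show ?thesis unfolding marked_order_polyhedron_def by auto
qed

section \<open>Strict and violating points\<close>

text \<open>Non-redundancy of a covering relation that starts at \<open>a\<close> applies to the
  marked elements \<open>a\<close> and \<open>b\<close> themselves.\<close>

lemma regular_marking_strict:
  fixes M :: "'p::{finite,order} set"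
  assumes "regular_marking M lam" "a \<in> M" "b \<in> M" "a < b"
  shows "lam a < lam b"
proof -
  obtain r where "covered_by a r" "r \<le> b" using covered_by_below[OF \<open>a < b\<close>] .
  moreover from this have "a \<le> r" by (simp add: covered_by_def less_imp_le)
  ultimately show ?thesis
    using assms unfolding regular_marking_def nonredundant_def by (metis order_less_imp_le less_irrefl)
qed

lemma ex_strict_point:
  fixes M :: "'p::{finite,order} set"
  assumes "regular_marking M lam"
  obtains w :: "real ^ 'p::{finite,order}" where "\<forall>a\<in>M. w $ a = lam a" "\<And>r s. covered_by r s \<Longrightarrow> w $ r < w $ s"
proof -
  obtain h where "\<forall>a\<in>M. h a = lam a" "\<forall>a b. a < b \<longrightarrow> h a < h b"
    using strict_mono_extension[of "(<)" M lam] regular_marking_strict[OF assms] by auto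
  then show ?thesis using that[of "\<chi> i. h i"] by (auto simp: covered_by_def)
qed

text \<open>
  The order is modified by turning the single covering relation \<open>p \<prec> q\<close> around; the marking remains
  strictly monotone for the modified order precisely because \<open>p \<prec> q\<close> is non-redundant.
\<close>

lemma ex_violating_point:
  fixes M :: "'p::{finite,order} set"
  assumes reg: "regular_marking M lam" and pq: "covered_by p q"
  obtains z :: "real ^ 'p::{finite,order}" where "\<forall>a\<in>M. z $ a = lam a" "z $ q < z $ p"
    "\<And>r s. covered_by r s \<Longrightarrow> (r, s) \<noteq> (p, q) \<Longrightarrow> z $ r < z $ s"
proof -
  \<comment> \<open>This is the transitive closure of the strict order with the pair
    \<open>(p, q)\<close> replaced by \<open>(q, p)\<close>. The second disjunct describes the
    chains from \<open>r\<close> up to \<open>q\<close>, over to \<open>p\<close> and up to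
    \<open>s\<close>; the conditions \<open>r \<noteq> p\<close> and \<open>s \<noteq> q\<close>
    stop them from using the deleted pair.\<close>
  define R where "R r s \<longleftrightarrow> r < s \<and> (r, s) \<noteq> (p, q) \<or> r \<le> q \<and> r \<noteq> p \<and> p \<le> s \<and> s \<noteq> q" for r s
  have cov: "p < q" "\<And>r. p \<le> r \<Longrightarrow> r \<le> q \<Longrightarrow> r = p \<or> r = q"
    using pq unfolding covered_by_def by (auto simp: less_le)
  have irr: "irreflp R" unfolding irreflp_def R_def using cov by blast
  have tr: "transp R"
  proof (rule transpI)
    fix r s t assume "R r s" "R s t"
    then consider "r < s" "(r, s) \<noteq> (p, q)" "s < t"
      | "r < s" "(r, s) \<noteq> (p, q)" "s \<le> q" "s \<noteq> p" "p \<le> t" "t \<noteq> q"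
      | "r \<le> q" "r \<noteq> p" "p \<le> s" "s \<noteq> q" "s < t" "(s, t) \<noteq> (p, q)"
      | "r \<le> q" "r \<noteq> p" "p \<le> t" "t \<noteq> q"
      unfolding R_def by blast
    \<comment> \<open>As nothing lies strictly between \<open>p\<close> and \<open>q\<close>,
      composing two steps never yields one of the excluded pairs.\<close>
    then show "R r t"
    proof cases
      case 1
      then have "(r, t) \<noteq> (p, q)" using cov(2)[of s] by (auto simp: less_imp_le)
      with 1 show ?thesis unfolding R_def by auto
    next
      case 2
      then have "r \<noteq> p" using cov(2)[of s] by (auto simp: less_imp_le)
      with 2 show ?thesis unfolding R_def by auto
    next
      case 3
      then have "t \<noteq> q" using cov(2)[of s] by (auto simp: less_imp_le)
      with 3 show ?thesis unfolding R_def by auto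
    next
      case 4
      then show ?thesis unfolding R_def by auto
    qed
  qed
  have "lam a < lam b" if ab: "a \<in> M" "b \<in> M" "R a b" for a b
  proof (cases "a < b")
    case True
    with reg ab show ?thesis by (blast intro: regular_marking_strict)
  next
    case False
    with ab have "a \<le> q" "p \<le> b" unfolding R_def by auto
    with reg pq ab have "a = b \<or> lam a < lam b"
      unfolding regular_marking_def nonredundant_def by blast
    with ab irr show ?thesis by (auto dest: irreflpD)
  qed
  with irr tr obtain h where h: "\<forall>a\<in>M. h a = lam a" "\<forall>a b. R a b \<longrightarrow> h a < h b"
    using strict_mono_extension[of R M lam] by auto
  have "R q p" using cov unfolding R_def by auto
  moreover have "R r s" if "covered_by r s" "(r, s) \<noteq> (p, q)" for r s
    using that unfolding R_def covered_by_def by auto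
  ultimately show ?thesis using h that[of "\<chi> i. h i"] by auto
qed

section \<open>Faces of covering relations and their partitions\<close>

definition cover_face :: "'p::{finite,order} set \<Rightarrow> ('p \<Rightarrow> real) \<Rightarrow> 'p \<Rightarrow> 'p \<Rightarrow> (real ^ 'p::{finite,order}) set"
  where "cover_face M lam p q = marked_order_polyhedron M lam \<inter> {x. x $ p = x $ q}"

lemma convex_cover_face: "convex (cover_face M lam p q)"
proof (rule convexI)
  fix x y :: "real ^ 'a::{finite,order}" and u v :: real
  assume "x \<in> cover_face M lam p q" "y \<in> cover_face M lam p q" and uv: "0 \<le> u" "0 \<le> v" "u + v = 1"
  moreover have "u * c + v * c = c" for c using uv by (metis distrib_right mult_1)
  ultimately show "u *\<^sub>R x + v *\<^sub>R y \<in> cover_face M lam p q"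
    unfolding cover_face_def marked_order_polyhedron_def by (auto intro!: add_mono mult_left_mono)
qed

lemma ex_generic_point_cover_face:
  fixes M :: "'p::{finite,order} set"
  assumes reg: "regular_marking M lam" and pq: "covered_by p q"
  obtains y where "y \<in> cover_face M lam p q"
    "\<And>r s. covered_by r s \<Longrightarrow> (r, s) \<noteq> (p, q) \<Longrightarrow> y $ r < y $ s"
proof -
  obtain w :: "real ^ 'p::{finite,order}" where w: "\<forall>a\<in>M. w $ a = lam a" "\<And>r s. covered_by r s \<Longrightarrow> w $ r < w $ s"
    using ex_strict_point[OF reg] by blast
  obtain z :: "real ^ 'p::{finite,order}" where z: "\<forall>a\<in>M. z $ a = lam a" "z $ q < z $ p"
    "\<And>r s. covered_by r s \<Longrightarrow> (r, s) \<noteq> (p, q) \<Longrightarrow> z $ r < z $ s"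
    using ex_violating_point[OF reg pq] by blast
  \<comment> \<open>\<open>u\<close> measures how far \<open>z\<close> violates the inequality and
    \<open>v\<close> how much slack \<open>w\<close> has. Weighting \<open>w\<close> by
    \<open>u\<close> and \<open>z\<close> by \<open>v\<close> makes the two cancel, so the
    \<open>p\<close> and \<open>q\<close> coordinates of \<open>y\<close> agree; positive weights
    preserve the other strict inequalities.\<close>
  define u v where "u = z $ p - z $ q" and "v = w $ q - w $ p"
  have uv: "0 < u" "0 < v" using z(2) w(2)[OF pq] unfolding u_def v_def by auto
  define y where "y = (u / (u + v)) *\<^sub>R w + (v / (u + v)) *\<^sub>R z"
  have y: "y $ i = (u * w $ i + v * z $ i) / (u + v)" for i
    unfolding y_def by (simp add: add_divide_distrib)
  have strict: "y $ r < y $ s" if "covered_by r s" "(r, s) \<noteq> (p, q)" for r s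
    using uv w(2)[OF that(1)] z(3)[OF that] unfolding y
    by (intro divide_strict_right_mono add_strict_mono mult_strict_left_mono) auto
  have tie: "y $ p = y $ q"
    unfolding y u_def v_def by (simp add: algebra_simps)
  have "y $ r \<le> y $ s" if "covered_by r s" for r s
    using strict[OF that] tie by (cases "(r, s) = (p, q)") auto
  moreover have "y $ a = lam a" if "a \<in> M" for a
    using that uv w(1) z(1) unfolding y by (simp add: field_simps)
  ultimately have "y \<in> cover_face M lam p q"
    using tie unfolding cover_face_def marked_order_polyhedron_covered_by by auto
  with strict that show ?thesis by blast
qed

text \<open>By monotonicity, a tie between \<open>r < s\<close> forces a tie on a covering relation
  that starts at \<open>r\<close>, which can only be \<open>p\<close> below \<open>q\<close>. A tie
  reaching beyond \<open>q\<close> would leave a tie starting at \<open>q\<close>, which is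
  impossible since \<open>q \<noteq> p\<close>.\<close>

lemma point_partition_generic:
  fixes x :: "real ^ 'p::{finite,order}"
  assumes mono: "\<And>r s. r \<le> s \<Longrightarrow> x $ r \<le> x $ s" and pq: "covered_by p q" and tie: "x $ p = x $ q"
    and strict: "\<And>r s. covered_by r s \<Longrightarrow> (r, s) \<noteq> (p, q) \<Longrightarrow> x $ r < x $ s"
  shows "point_partition x = pair_partition p q"
proof -
  have "p < q" using pq by (simp add: covered_by_def)
  have *: "r = p \<and> covered_by r q \<and> q \<le> s" if "r < s" "x $ r = x $ s" for r s
  proof -
    obtain t where t: "covered_by r t" "t \<le> s" using covered_by_below[OF \<open>r < s\<close>] .
    then have "x $ t \<le> x $ r" using mono[of t s] that by simp
    with strict[OF t(1)] have "(r, t) = (p, q)" by force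
    with t show ?thesis by auto
  qed
  have **: "r = p \<and> s = q" if "r < s" "x $ r = x $ s" for r s
  proof -
    have "r = p" "q \<le> s" using *[OF that] by auto
    moreover have "\<not> q < s"
      using *[of q s] tie that \<open>p < q\<close> \<open>r = p\<close> by auto
    ultimately show ?thesis by (auto simp: less_le)
  qed
  have "(r, s) \<in> tie_rel x \<longleftrightarrow> r = s \<or> r = p \<and> s = q \<or> r = q \<and> s = p" for r s
    using **[of r s] **[of s r] tie \<open>p < q\<close> unfolding tie_rel_def by (auto simp: le_less)
  then have "tie_rel x = Id \<union> {(p, q), (q, p)}" by auto
  moreover from this have "trans (tie_rel x)" by (auto simp: trans_def)
  ultimately have "(tie_rel x)\<^sup>+ = Id \<union> {(p, q), (q, p)}" by (simp add: trancl_id)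
  moreover have "(Id \<union> {(p, q), (q, p)}) `` {r} = (if r = p \<or> r = q then {p, q} else {r})" for r
    using \<open>p < q\<close> by auto
  \<comment> \<open>Both partitions are brought to the same form, listing the block of each element
    \<open>r\<close>.\<close>
  ultimately have "B \<in> point_partition x \<longleftrightarrow> (\<exists>r. B = (if r = p \<or> r = q then {p, q} else {r}))" for B
    unfolding point_partition_def quotient_def by simp
  moreover have "B \<in> pair_partition p q \<longleftrightarrow> (\<exists>r. B = (if r = p \<or> r = q then {p, q} else {r}))" for B
    unfolding pair_partition_def by (simp only: insert_iff mem_Collect_eq) metis
  ultimately show ?thesis by (intro set_eqI) (simp only:)
qed

text \<open>A segment from the generic point \<open>y\<close> to a relative interior point
  \<open>x\<close> extends slightly beyond \<open>x\<close> inside the face. If \<open>x\<close> had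
  a further tie at \<open>r\<close> and \<open>s\<close>, the negative coefficient
  \<open>1 - e\<close> of \<open>y\<close> would reverse \<open>y $ r < y $ s\<close> at the
  extended point.\<close>

lemma is_face_partition_cover_face:
  fixes M :: "'p::{finite,order} set"
  assumes reg: "regular_marking M lam" and pq: "covered_by p q"
  shows "is_face_partition (cover_face M lam p q) (pair_partition p q)"
proof -
  let ?F = "cover_face M lam p q"
  obtain y where y: "y \<in> ?F" "\<And>r s. covered_by r s \<Longrightarrow> (r, s) \<noteq> (p, q) \<Longrightarrow> y $ r < y $ s"
    using ex_generic_point_cover_face[OF reg pq] by blast
  then have ne: "rel_interior ?F \<noteq> {}"
    using rel_interior_eq_empty[OF convex_cover_face] by blast
  have "point_partition x = pair_partition p q" if x: "x \<in> rel_interior ?F" for x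
  proof (rule point_partition_generic[OF _ pq])
    have xF: "x \<in> ?F" using x rel_interior_subset by blast
    then show "x $ p = x $ q" "\<And>r s. r \<le> s \<Longrightarrow> x $ r \<le> x $ s"
      unfolding cover_face_def marked_order_polyhedron_def by auto
    fix r s assume rs: "covered_by r s" "(r, s) \<noteq> (p, q)"
    obtain e where e: "e > 1" "(1 - e) *\<^sub>R y + e *\<^sub>R x \<in> ?F"
      using convex_rel_interior_iff[OF convex_cover_face] ne x y(1) by blast
    have "x $ r \<le> x $ s"
      using xF rs unfolding cover_face_def marked_order_polyhedron_covered_by by blast
    moreover have "x $ r \<noteq> x $ s"
    proof
      assume "x $ r = x $ s"
      moreover have "((1 - e) *\<^sub>R y + e *\<^sub>R x) $ r \<le> ((1 - e) *\<^sub>R y + e *\<^sub>R x) $ s"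
        using e(2) rs unfolding cover_face_def marked_order_polyhedron_covered_by by blast
      ultimately have "(1 - e) * y $ r \<le> (1 - e) * y $ s" by simp
      then show False using e(1) y(2)[OF rs] by (simp add: mult_le_cancel_left)
    qed
    ultimately show "x $ r < x $ s" by simp
  qed
  with ne show ?thesis unfolding is_face_partition_def by blast
qed

section \<open>Recovering the covering relation from the partition\<close>

lemma is_face_partition_unique:
  assumes "is_face_partition F \<pi>" "is_face_partition F \<rho>"
  shows "\<pi> = \<rho>"
proof -
  obtain x where "x \<in> rel_interior F" using assms(1) unfolding is_face_partition_def by blast
  with assms show ?thesis unfolding is_face_partition_def by blast
qed

text \<open>The only non-singleton block determines the unordered pair, and the strict order
  determines its orientation.\<close>

lemma pair_partition_inject:
  fixes p q r s :: "'p::order"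
  assumes "pair_partition p q = pair_partition r s" "p < q" "r < s"
  shows "p = r \<and> q = s"
proof -
  have "{p, q} \<in> pair_partition r s" using assms(1) unfolding pair_partition_def by blast
  moreover have "{p, q} \<noteq> {t}" for t using \<open>p < q\<close> by auto
  ultimately have "{p, q} = {r, s}" unfolding pair_partition_def by auto
  with assms show ?thesis by (auto simp: doubleton_eq_iff)
qed

section \<open>Affine hull and facets\<close>

text \<open>The points that are strict on all covering relations form a relatively open subset of
  the affine space given by the marking equations. It is non-empty by regularity, so it already
  spans that space, and it lies in the polyhedron.\<close>

lemma affine_hull_marked_order_polyhedron:
  fixes M :: "'p::{finite,order} set"
  assumes "regular_marking M lam"
  shows "affine hull (marked_order_polyhedron M lam) = {x. \<forall>a\<in>M. x $ a = lam a}"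
proof
  let ?A = "{x :: real ^ 'p::{finite,order}. \<forall>a\<in>M. x $ a = lam a}"
  let ?U = "\<Inter>(r, s) \<in> {(r, s). covered_by r s}. {x :: real ^ 'p::{finite,order}. x $ r < x $ s}"
  have A: "affine ?A"
    unfolding affine_def by (auto simp flip: distrib_right)
  show "affine hull (marked_order_polyhedron M lam) \<subseteq> ?A"
    by (rule hull_minimal[where S = affine]) (use A in \<open>auto simp: marked_order_polyhedron_def\<close>)
  have "open ?U"
    by (intro open_INT) (auto intro!: open_Collect_less continuous_intros)
  moreover obtain w :: "real ^ 'p::{finite,order}"
    where "\<forall>a\<in>M. w $ a = lam a" "\<And>r s. covered_by r s \<Longrightarrow> w $ r < w $ s"
    using ex_strict_point[OF assms] by blast
  then have "?A \<inter> ?U \<noteq> {}" by blast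
  ultimately have "affine hull (?A \<inter> ?U) = affine hull ?A"
    by (rule affine_hull_affine_Int_open[OF A])
  also have "\<dots> = ?A"
    using A by (simp only: affine_hull_eq)
  finally have "affine hull (?A \<inter> ?U) = ?A" .
  moreover have "?A \<inter> ?U \<subseteq> marked_order_polyhedron M lam"
    unfolding marked_order_polyhedron_covered_by by (auto simp: less_imp_le)
  then have "affine hull (?A \<inter> ?U) \<subseteq> affine hull (marked_order_polyhedron M lam)"
    by (rule hull_mono)
  ultimately show "?A \<subseteq> affine hull (marked_order_polyhedron M lam)"
    by (simp only:)
qed

lemma facet_of_marked_order_polyhedron_iff:
  fixes M :: "'p::{finite,order} set"
  assumes reg: "regular_marking M lam"
  shows "F facet_of marked_order_polyhedron M lam \<longleftrightarrow>
    (\<exists>p q. covered_by p q \<and> F = cover_face M lam p q)"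
proof -
  let ?S = "marked_order_polyhedron M lam"
  let ?C = "{pq :: 'p \<times> 'p. covered_by (fst pq) (snd pq)}"
  define n :: "'p \<times> 'p \<Rightarrow> real ^ 'p::{finite,order}" where "n = (\<lambda>(p, q). axis p 1 - axis q 1)"
  define H where "H = (\<lambda>pq. {x. n pq \<bullet> x \<le> 0})"
  have n: "n (p, q) \<bullet> x = x $ p - x $ q" for p q x
    unfolding n_def by (simp add: inner_diff_left inner_axis')
  \<comment> \<open>These witnesses of irredundancy serve three times: for injectivity of
    \<open>H\<close>, for non-zero normals and for strict growth of the set when a halfspace is
    dropped.\<close>
  have viol: "\<exists>z. z \<in> affine hull ?S \<and> z \<notin> H pq \<and> (\<forall>rs \<in> ?C - {pq}. z \<in> H rs)"
    if "pq \<in> ?C" for pq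
  proof -
    obtain p q where [simp]: "pq = (p, q)" by fastforce
    have "covered_by p q" using that by simp
    from ex_violating_point[OF reg this]
    obtain z :: "real ^ 'p::{finite,order}" where "\<forall>a\<in>M. z $ a = lam a" "z $ q < z $ p"
      "\<And>r s. covered_by r s \<Longrightarrow> (r, s) \<noteq> (p, q) \<Longrightarrow> z $ r < z $ s" by blast
    then show ?thesis
      unfolding affine_hull_marked_order_polyhedron[OF reg] H_def
      by (intro exI[of _ z]) (force simp: n less_imp_le)
  qed
  have inj: "inj_on H ?C"
    by (rule inj_onI) (use viol in blast)
  \<comment> \<open>\<open>facet_of_polyhedron_explicit\<close> indexes the facets by halfspaces, so
    \<open>c\<close> recovers the covering relation from its halfspace.\<close>
  define c where "c = inv_into ?C H"
  have "F facet_of ?S \<longleftrightarrow> (\<exists>h. h \<in> H ` ?C \<and> F = ?S \<inter> {x. n (c h) \<bullet> x = 0})"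
  proof (rule facet_of_polyhedron_explicit[where b = "\<lambda>_. 0"])
    show "?S = affine hull ?S \<inter> \<Inter> (H ` ?C)"
      unfolding affine_hull_marked_order_polyhedron[OF reg]
      by (auto simp: marked_order_polyhedron_covered_by H_def n)
  next
    fix h assume h: "h \<in> H ` ?C"
    then have "c h \<in> ?C" "H (c h) = h" unfolding c_def using inv_into_into[OF h] f_inv_into_f[OF h] by auto
    moreover have "n pq \<noteq> 0" if pq: "pq \<in> ?C" for pq
      using viol[OF pq] unfolding H_def by auto
    ultimately show "n (c h) \<noteq> 0 \<and> h = {x. n (c h) \<bullet> x \<le> 0}" unfolding H_def by auto
  next
    \<comment> \<open>The point violating an omitted inequality \<open>pq\<close> satisfies every
      inequality kept in \<open>G\<close> but lies outside the polyhedron.\<close>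
    fix G assume G: "G \<subset> H ` ?C"
    then obtain pq where pq: "pq \<in> ?C" "H pq \<notin> G" by auto
    obtain z where z: "z \<in> affine hull ?S" "z \<notin> H pq" "\<forall>rs \<in> ?C - {pq}. z \<in> H rs"
      using viol[OF pq(1)] by blast
    have "z \<in> affine hull ?S \<inter> \<Inter> G" using z G pq by blast
    moreover have "?S \<subseteq> H rs" if "rs \<in> ?C" for rs
      using that by (cases rs) (auto simp: H_def n marked_order_polyhedron_covered_by)
    then have "?S \<subseteq> affine hull ?S \<inter> \<Inter> G" "z \<notin> ?S"
      using G z pq hull_subset[of ?S affine] by blast+
    ultimately show "?S \<subset> affine hull ?S \<inter> \<Inter> G" by blast
  qed auto
  also have "\<dots> \<longleftrightarrow> (\<exists>pq\<in>?C. F = ?S \<inter> {x. n pq \<bullet> x = 0})"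
    using inj unfolding c_def by auto
  also have "\<dots> \<longleftrightarrow> (\<exists>p q. covered_by p q \<and> F = cover_face M lam p q)"
    by (simp add: n cover_face_def)
  finally show ?thesis .
qed

section \<open>The bijection between covering relations and facets\<close>

theorem theorem3p22:
  fixes M :: "'p::{finite,order} set" and lam :: "'p \<Rightarrow> real"
  assumes "mono_on M lam"
    and "regular_marking M lam"
  shows "(\<exists>f. bij_betw f {(p, q). covered_by p q} {F. F facet_of marked_order_polyhedron M lam} \<and>
              (\<forall>p q. covered_by p q \<longrightarrow> is_face_partition (f (p, q)) (pair_partition p q))) \<and>
         (\<forall>F. F facet_of marked_order_polyhedron M lam \<longrightarrow>
              (\<exists>!pq. covered_by (fst pq) (snd pq) \<and> is_face_partition F (pair_partition (fst pq) (snd pq))))"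
proof -
  let ?f = "\<lambda>(p, q). cover_face M lam p q"
  note facets = facet_of_marked_order_polyhedron_iff[OF assms(2)]
  note partition = is_face_partition_cover_face[OF assms(2)]
  \<comment> \<open>A face has at most one face partition, and that partition determines the pair;
    this yields both injectivity of \<open>?f\<close> and the uniqueness claim.\<close>
  have unique: "p = r \<and> q = s"
    if "covered_by p q" "covered_by r s"
      "is_face_partition F (pair_partition p q)" "is_face_partition F (pair_partition r s)" for p q r s :: 'p and F
    using pair_partition_inject is_face_partition_unique[OF that(3,4)] that(1,2)
    by (auto simp: covered_by_def)
  have "inj_on ?f {(p, q). covered_by p q}"
    proof (rule inj_onI, clarify)
    fix p q r s assume "covered_by p q" "covered_by r s" "cover_face M lam p q = cover_face M lam r s"
    then show "p = r \<and> q = s" using unique partition by metis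
  qed
  moreover have "?f ` {(p, q). covered_by p q} = {F. F facet_of marked_order_polyhedron M lam}"
    using facets by auto
  ultimately have "bij_betw ?f {(p, q). covered_by p q} {F. F facet_of marked_order_polyhedron M lam}"
    by (simp add: bij_betw_def)
  moreover have "\<exists>!pq. covered_by (fst pq) (snd pq) \<and> is_face_partition F (pair_partition (fst pq) (snd pq))"
    if F: "F facet_of marked_order_polyhedron M lam" for F
  proof -
    obtain p q where pq: "covered_by p q" "F = cover_face M lam p q" using F facets by blast
    have "is_face_partition F (pair_partition p q)" using partition pq by simp
    with pq(1) show ?thesis
      by (intro ex1I[of _ "(p, q)"]) (simp, metis unique prod.collapse)
  qed
  ultimately show ?thesis
    using partition by (intro conjI exI[of _ ?f]) auto
qed

end
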